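(* Let $P$ be a strictly convex labeled hexagon in $\mathbb{R}^2$ whose vertices are labeled in cyclic order. Put $G_P=L_P-3I$, $\mathcal S(P)=\frac12\operatorname{tr}((G_P-I)^2)$, $\mathcal R(P)=\det(G_P-I)$ and $\Delta_P=4\mathcal S(P)^3-27\mathcal R(P)^2$. Then $$\mathcal S(P)>0\quad\text{and}\quad\mathcal R(P)>0.$$ Consequently, $G_P$ has a unique eigenvalue of maximal modulus. More precisely: (i) if $\Delta_P<0$, then $G_P$ has one real eigenvalue and a non-real conjugate pair, and the real eigenvalue is strictly dominant over the pair; (ii) if $\Delta_P=0$, then for a unique $s>0$, $\operatorname{Spec}(G_P)=\{1+2s,1-s,1-s\}$, and $1+2s$ is strictly dominant; (iii) if $\Delta_P>0$, the three eigenvalues are real and one of them has strictly largest modulus. The two subordinate eigenvalues have the same modulus precisely when $$\mathcal R(P)=8-2\mathcal S(P),\qquad3<\mathcal S(P)<4,$$ in which case $\operatorname{Spec}(G_P)=\{3,\sqrt{\mathcal S(P)-3},-\sqrt{\mathcal S(P)-3}\}$.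
   Context: Glick's operator: for a labeled $n$-gon $P=(p_1,\dots,p_n)$ (indices modulo $n$; here $n=6$) such that every consecutive triple of vertices is noncollinear, with nonzero homogeneous lifts $\widetilde p_i\in\mathbb{R}^3$ (points of $\mathbb{R}^2$ being embedded in $\mathbb{RP}^2$ via $x\mapsto[x:1]$), $$L_P(v)=nv-\sum_{j=1}^n\frac{\det(\widetilde p_{j-1},v,\widetilde p_{j+1})}{\det(\widetilde p_{j-1},\widetilde p_j,\widetilde p_{j+1})}\,\widetilde p_j ,\qquad v\in\mathbb{R}^3,$$ independent of the lifts. "Strictly dominant" means of strictly largest modulus. Spectra are listed with multiplicity. *)

theory Defs
  imports "HOL-Analysis.Analysis"
begin

text \<open>
  A labeled \<open>n\<close>-gon is a map on \<open>nat\<close>, of which only the values at \<open>{..<n}\<close> matter; indices are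
  read modulo \<open>n\<close>. It is strictly convex and labeled in cyclic order if its vertices are pairwise
  distinct extreme points of their convex hull and the sides joining consecutive vertices are edges
  of that hull. In particular no three vertices are collinear.
\<close>

definition strictly_convex_polygon :: "nat \<Rightarrow> (nat \<Rightarrow> real^2) \<Rightarrow> bool" where
  "strictly_convex_polygon n p \<longleftrightarrow>
     inj_on p {..<n} \<and>
     (\<forall>i<n. p i extreme_point_of (convex hull (p ` {..<n}))) \<and>
     (\<forall>i<n. closed_segment (p i) (p ((i + 1) mod n)) edge_of (convex hull (p ` {..<n})))"

definition homogeneous_lift :: "real^3 \<Rightarrow> real^2 \<Rightarrow> bool" where
  "homogeneous_lift q x \<longleftrightarrow> (\<exists>c. c \<noteq> 0 \<and> q = c *\<^sub>R vector [x $ 1, x $ 2, 1])"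

definition det3 :: "real^3 \<Rightarrow> real^3 \<Rightarrow> real^3 \<Rightarrow> real" where
  "det3 u v w = det (vector [u, v, w] :: real^3^3)"

text \<open>
  In the following, \<open>q\<close> is a family of homogeneous lifts of the vertices. The index \<open>j - 1\<close> is
  written \<open>j + (n - 1)\<close>, because subtraction on \<open>nat\<close> is truncated.
\<close>

definition glick :: "nat \<Rightarrow> (nat \<Rightarrow> real^3) \<Rightarrow> real^3 \<Rightarrow> real^3" where
  "glick n q v = real n *\<^sub>R v -
     (\<Sum>j<n. (det3 (q ((j + (n - 1)) mod n)) v (q ((j + 1) mod n)) /
              det3 (q ((j + (n - 1)) mod n)) (q j) (q ((j + 1) mod n))) *\<^sub>R q j)"

text \<open>Note that \<open>mat c\<close> is the scalar matrix \<open>c I\<close>.\<close>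

definition glick_G :: "(nat \<Rightarrow> real^3) \<Rightarrow> real^3^3" where
  "glick_G q = matrix (glick 6 q) - mat 3"

definition glick_S :: "(nat \<Rightarrow> real^3) \<Rightarrow> real" where
  "glick_S q = trace ((glick_G q - mat 1) ** (glick_G q - mat 1)) / 2"

definition glick_R :: "(nat \<Rightarrow> real^3) \<Rightarrow> real" where
  "glick_R q = det (glick_G q - mat 1)"

definition glick_Delta :: "(nat \<Rightarrow> real^3) \<Rightarrow> real" where
  "glick_Delta q = 4 * glick_S q ^ 3 - 27 * glick_R q ^ 2"

definition charpoly :: "'a::comm_ring_1^'n^'n \<Rightarrow> 'a poly" where
  "charpoly A = det (mat [:0, 1:] - (\<chi> i j. [:A $ i $ j:]))"

text \<open>The complex eigenvalues of a real matrix, with algebraic multiplicity.\<close>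

definition Spec :: "real^'n^'n \<Rightarrow> complex multiset" where
  "Spec A = proots (charpoly (\<chi> i j. complex_of_real (A $ i $ j)))"

text \<open>
  Only one copy of \<open>l\<close> is removed, so that a strictly dominant element has multiplicity one.
\<close>

definition strictly_dominant :: "complex \<Rightarrow> complex multiset \<Rightarrow> bool" where
  "strictly_dominant l M \<longleftrightarrow> l \<in># M \<and> (\<forall>m \<in># M - {#l#}. cmod m < cmod l)"

end

theory Submission
  imports Defs
begin

text \<open>
  Put \<open>M = G - I\<close>, and rescale the lifts so that the determinant of two consecutive lifts and any
  third one is positive. Since \<open>\<ell>\<^sub>j(v) = det (q\<^sub>j\<^sub>-\<^sub>1, v, q\<^sub>j\<^sub>+\<^sub>1) / det (q\<^sub>j\<^sub>-\<^sub>1, q\<^sub>j, q\<^sub>j\<^sub>+\<^sub>1)\<close>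
  vanishes at \<open>q\<^sub>j\<^sub>-\<^sub>1\<close> and \<open>q\<^sub>j\<^sub>+\<^sub>1\<close>, we have
  \<open>M q\<^sub>0 = q\<^sub>0 - \<ell>\<^sub>2(q\<^sub>0) q\<^sub>2 - \<ell>\<^sub>3(q\<^sub>0) q\<^sub>3 - \<ell>\<^sub>4(q\<^sub>0) q\<^sub>4\<close>. Expanding \<open>q\<^sub>3\<close> in the basis
  \<open>q\<^sub>0, q\<^sub>2, q\<^sub>4\<close> by Cramer's rule cancels the \<open>q\<^sub>0\<close>-term and leaves positive coefficients. So in this
  basis \<open>M\<close> has zero diagonal and positive off-diagonal entries, whence \<open>S > 0\<close> and \<open>R > 0\<close>.

  The characteristic polynomial of \<open>M\<close> is \<open>x\<^sup>3 - S x - R\<close>. For a positive root \<open>m\<close>, the other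
  two roots have sum \<open>- m\<close> and product \<open>m\<^sup>2 - S > 0\<close>, and
  \<open>\<Delta> = (4 S - 3 m\<^sup>2) (3 m\<^sup>2 - S)\<^sup>2\<close> has the sign of the discriminant of their quadratic.
\<close>

subsection \<open>Orientation of a strictly convex hexagon\<close>

lemma det3_expand:
  "det3 u v w = u $ 1 * v $ 2 * w $ 3 + u $ 2 * v $ 3 * w $ 1 + u $ 3 * v $ 1 * w $ 2
     - u $ 1 * v $ 3 * w $ 2 - u $ 2 * v $ 1 * w $ 3 - u $ 3 * v $ 2 * w $ 1"
  by (simp add: det3_def det_3)

lemma det3_scaleR [simp]:
  "det3 (c *\<^sub>R u) v w = c * det3 u v w"
  "det3 u (c *\<^sub>R v) w = c * det3 u v w"
  "det3 u v (c *\<^sub>R w) = c * det3 u v w"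
  by (simp_all add: det3_expand algebra_simps)

lemma det3_same [simp]: "det3 u u v = 0" "det3 u v u = 0" "det3 u v v = 0"
  by (simp_all add: det3_expand)

lemma det3_rotate: "det3 v w u = det3 u v w"
  by (simp add: det3_expand)

lemma det3_swap: "det3 v u w = - det3 u v w"
  by (simp add: det3_expand)

text \<open>With the denominator cleared, Cramer's rule is a polynomial identity in the
  coordinates.\<close>

lemma det3_cramer:
  "det3 u v w *\<^sub>R x = det3 x v w *\<^sub>R u + det3 u x w *\<^sub>R v + det3 u v x *\<^sub>R w"
  by (simp add: vec_eq_iff forall_3 det3_expand) algebra

text \<open>Three-term Grassmann-Pluecker relation. It gives access to the sign of a triple of
  alternate vertices, which contains no side of the hexagon.\<close>

lemma det3_plucker:
  "det3 u a c * det3 u b d = det3 u a b * det3 u c d + det3 u a d * det3 u b c"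
  unfolding det3_expand by algebra

section \<open>Extreme points, faces and sides of a line in terms of determinants\<close>

definition lift :: "real^2 \<Rightarrow> real^3" where
  "lift x = vector [x $ 1, x $ 2, 1]"

lemma det3_lift_affine:
  "det3 (lift u) (lift v) (lift ((1 - s) *\<^sub>R x + s *\<^sub>R y))
     = (1 - s) * det3 (lift u) (lift v) (lift x) + s * det3 (lift u) (lift v) (lift y)"
  by (simp add: det3_expand lift_def algebra_simps)

text \<open>The determinant is twice the signed area of the triangle, so its vanishing makes
  \<open>x - u\<close> parallel to \<open>v - u\<close>. Some coordinate of \<open>v - u\<close> is
  nonzero and determines \<open>t\<close>.\<close>

lemma det3_lift_eq_0:
  assumes "det3 (lift u) (lift v) (lift x) = 0" and "u \<noteq> v"
  obtains t where "x = (1 - t) *\<^sub>R u + t *\<^sub>R v"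
proof -
  from assms(1) have *: "(v $ 1 - u $ 1) * (x $ 2 - u $ 2) = (v $ 2 - u $ 2) * (x $ 1 - u $ 1)"
    by (simp add: det3_expand lift_def algebra_simps)
  have "v $ 1 - u $ 1 \<noteq> 0 \<or> v $ 2 - u $ 2 \<noteq> 0"
    using assms(2) by (auto simp: vec_eq_iff forall_2)
  then show thesis
  proof
    assume nz: "v $ 1 - u $ 1 \<noteq> 0"
    define t where "t = (x $ 1 - u $ 1) / (v $ 1 - u $ 1)"
    have 1: "x $ 1 - u $ 1 = t * (v $ 1 - u $ 1)" using nz by (simp add: t_def)
    then have "x $ 2 - u $ 2 = t * (v $ 2 - u $ 2)" using nz * by (simp add: mult.commute)
    with 1 show thesis
      by (intro that[of t]) (simp add: vec_eq_iff forall_2 algebra_simps)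
  next
    assume nz: "v $ 2 - u $ 2 \<noteq> 0"
    define t where "t = (x $ 2 - u $ 2) / (v $ 2 - u $ 2)"
    have 2: "x $ 2 - u $ 2 = t * (v $ 2 - u $ 2)" using nz by (simp add: t_def)
    then have "x $ 1 - u $ 1 = t * (v $ 1 - u $ 1)" using nz * by (simp add: mult.commute)
    with 2 show thesis
      by (intro that[of t]) (simp add: vec_eq_iff forall_2 algebra_simps)
  qed
qed

text \<open>If \<open>x\<close> were on the line beyond \<open>u\<close> or beyond \<open>v\<close>,
  that end would lie strictly between \<open>x\<close> and the other end, against its
  extremality.\<close>

lemma on_line_of_extreme_points_imp_in_segment:
  assumes C: "u extreme_point_of C" "v extreme_point_of C" "x \<in> C"
    and x: "x = (1 - t) *\<^sub>R u + t *\<^sub>R v" and "u \<noteq> v"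
  shows "x \<in> closed_segment u v"
proof (rule ccontr)
  assume "x \<notin> closed_segment u v"
  then have t: "t < 0 \<or> t > 1"
    unfolding x in_segment by (metis linorder_not_le)
  have uv: "u \<in> C" "v \<in> C" "u \<notin> open_segment x v" "v \<notin> open_segment u x"
    using C unfolding extreme_point_of_def by blast+
  from t show False
  proof
    assume "t < 0"
    \<comment> \<open>Solving the equation of \<open>x\<close> for \<open>u\<close> gives the
      parameter of \<open>u\<close> on the segment from \<open>x\<close> to
      \<open>v\<close>.\<close>
    define s where "s = - t / (1 - t)"
    have "(1 - s) * (1 - t) = 1" "(1 - s) * t + s = 0"
      using \<open>t < 0\<close> by (simp_all add: s_def field_simps)
    then have "u = (1 - s) *\<^sub>R x + s *\<^sub>R v"
      by (simp add: x scaleR_add_right add.assoc flip: scaleR_add_left)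
    moreover have "0 < s" "s < 1"
      using \<open>t < 0\<close> by (simp_all add: s_def field_simps)
    moreover have "x \<noteq> v" using \<open>t < 0\<close> \<open>u \<noteq> v\<close> unfolding x
      by (auto simp: algebra_simps simp flip: scaleR_diff_right)
    ultimately have "u \<in> open_segment x v" by (auto simp: in_segment)
    with uv show False by simp
  next
    assume "t > 1"
    define s where "s = 1 / t"
    have "(1 - s) + s * (1 - t) = 0" "s * t = 1"
      using \<open>t > 1\<close> by (simp_all add: s_def field_simps)
    then have "v = (1 - s) *\<^sub>R u + s *\<^sub>R x"
      by (simp add: x scaleR_add_right flip: add.assoc scaleR_add_left)
    moreover have "0 < s" "s < 1"
      using \<open>t > 1\<close> by (simp_all add: s_def field_simps)
    moreover have "u \<noteq> x" using \<open>t > 1\<close> \<open>u \<noteq> v\<close> unfolding x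
      by (auto simp: algebra_simps simp flip: scaleR_diff_right)
    ultimately have "v \<in> open_segment u x" by (auto simp: in_segment)
    with uv show False by simp
  qed
qed

lemma extreme_points_noncollinear:
  assumes "u extreme_point_of C" "v extreme_point_of C" "x extreme_point_of C"
    and "u \<noteq> v" "x \<noteq> u" "x \<noteq> v"
  shows "det3 (lift u) (lift v) (lift x) \<noteq> 0"
proof
  assume "det3 (lift u) (lift v) (lift x) = 0"
  then obtain t where "x = (1 - t) *\<^sub>R u + t *\<^sub>R v"
    using det3_lift_eq_0 \<open>u \<noteq> v\<close> by blast
  then have "x \<in> closed_segment u v"
    using on_line_of_extreme_points_imp_in_segment assms unfolding extreme_point_of_def by blast
  then have "x \<in> open_segment u v"
    using assms by (simp add: open_segment_def)
  then show False
    using assms unfolding extreme_point_of_def by blast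
qed

text \<open>Otherwise the segment from \<open>x\<close> to \<open>y\<close> crosses the line through
  \<open>u\<close> and \<open>v\<close> at a point of \<open>C\<close>, hence on the face. The face
  property then puts \<open>x\<close> on that line, where the determinant is 0.\<close>

lemma face_same_side:
  assumes face: "closed_segment u v face_of C" and "convex C"
    and ext: "u extreme_point_of C" "v extreme_point_of C" and "u \<noteq> v" and xy: "x \<in> C" "y \<in> C"
  shows "\<not> (det3 (lift u) (lift v) (lift x) < 0 \<and> 0 < det3 (lift u) (lift v) (lift y))"
proof
  let ?d = "\<lambda>z. det3 (lift u) (lift v) (lift z)"
  assume sides: "?d x < 0 \<and> 0 < ?d y"
  \<comment> \<open>The zero of the affine function with value \<open>?d x\<close> at 0 and
    \<open>?d y\<close> at 1.\<close>
  define s where "s = ?d x / (?d x - ?d y)"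
  define z where "z = (1 - s) *\<^sub>R x + s *\<^sub>R y"
  have s: "0 < s" "s < 1" using sides by (simp_all add: s_def field_simps)
  have "?d z = (1 - s) * ?d x + s * ?d y"
    unfolding z_def by (rule det3_lift_affine)
  also have "\<dots> = 0" using sides by (simp add: s_def field_simps)
  finally have "?d z = 0" .
  then obtain t where t: "z = (1 - t) *\<^sub>R u + t *\<^sub>R v"
    using det3_lift_eq_0 \<open>u \<noteq> v\<close> by blast
  have "x \<noteq> y" using sides by auto
  then have z: "z \<in> open_segment x y"
    using s by (auto simp: in_segment z_def)
  have "z \<in> C"
    using \<open>convex C\<close> xy s unfolding z_def by (simp add: convexD)
  then have "z \<in> closed_segment u v"
    using on_line_of_extreme_points_imp_in_segment ext t \<open>u \<noteq> v\<close> by blast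
  then have "x \<in> closed_segment u v"
    using face z xy unfolding face_of_def by blast
  then obtain r where "x = (1 - r) *\<^sub>R u + r *\<^sub>R v"
    by (auto simp: in_segment)
  then have "?d x = 0"
    using det3_lift_affine[of u v r u v] by simp
  then show False using sides by simp
qed

text \<open>Extremality makes both determinants nonzero, and the face property excludes opposite
  signs. A product is used because the orientation may be either one.\<close>

lemma strictly_convex_polygon_same_side:
  assumes p: "strictly_convex_polygon n p" and "i < n" "k < n" "l < n"
    and nk: "k \<noteq> i" "k \<noteq> (i + 1) mod n" and nl: "l \<noteq> i" "l \<noteq> (i + 1) mod n" and "n > 1"
  shows "0 < det3 (lift (p i)) (lift (p ((i + 1) mod n))) (lift (p k)) *
             det3 (lift (p i)) (lift (p ((i + 1) mod n))) (lift (p l))"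
proof -
  let ?C = "convex hull (p ` {..<n})" and ?j = "(i + 1) mod n"
  let ?d = "\<lambda>k. det3 (lift (p i)) (lift (p ?j)) (lift (p k))"
  have inj: "inj_on p {..<n}" and ext: "\<And>i. i < n \<Longrightarrow> p i extreme_point_of ?C"
    and face: "closed_segment (p i) (p ?j) face_of ?C"
    using p \<open>i < n\<close> unfolding strictly_convex_polygon_def edge_of_def by blast+
  have j: "?j < n" "?j \<noteq> i"
    using \<open>i < n\<close> \<open>n > 1\<close> by (auto simp: mod_if)
  have ne: "p i \<noteq> p ?j" "p k \<noteq> p i" "p k \<noteq> p ?j" "p l \<noteq> p i" "p l \<noteq> p ?j"
    using inj_onD[OF inj] assms j by (metis lessThan_iff)+
  have "?d k \<noteq> 0" "?d l \<noteq> 0"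
    using extreme_points_noncollinear ext assms j ne by blast+
  moreover have "\<not> (?d k < 0 \<and> 0 < ?d l)" "\<not> (?d l < 0 \<and> 0 < ?d k)"
    using face_same_side[OF face convex_convex_hull ext[OF \<open>i < n\<close>] ext[OF j(1)] ne(1)] ext assms
    unfolding extreme_point_of_def by blast+
  ultimately show ?thesis
    by (metis linorder_neqE_linordered_idom mult_neg_neg mult_pos_pos)
qed

text \<open>Scaling all lifts by \<open>e\<close> multiplies every determinant by
  \<open>e\<close>^3. Taking the determinant of the first triple as \<open>e\<close> thus corrects a
  clockwise labeling, provided that all sides see the same sign.\<close>

lemma convex_hexagon_oriented_lift:
  assumes p: "strictly_convex_polygon 6 p"
  obtains e :: real where "e \<noteq> 0"
    and "\<And>i k. i < 6 \<Longrightarrow> k < 6 \<Longrightarrow> k \<noteq> i \<Longrightarrow> k \<noteq> (i + 1) mod 6 \<Longrightarrow>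
      0 < det3 (e *\<^sub>R lift (p i)) (e *\<^sub>R lift (p ((i + 1) mod 6))) (e *\<^sub>R lift (p k))"
proof -
  let ?d = "\<lambda>i j k. det3 (lift (p i)) (lift (p j)) (lift (p k))"
  define e where "e = ?d 0 1 2"
  note same = strictly_convex_polygon_same_side[OF p]
  have first: "0 < e * ?d i ((i + 1) mod 6) ((i + 2) mod 6)" if "i < 6" for i
    using that
  proof (induction i)
    case 0
    \<comment> \<open>Here the product is the square of \<open>e\<close>.\<close>
    then show ?case using same[of 0 2 2] by (simp add: e_def numeral_2_eq_2)
  next
    case (Suc i)
    let ?k = "(i + 2) mod 6" and ?l = "(i + 3) mod 6"
    have succ: "(Suc i + 1) mod 6 = ?k" "(Suc i + 2) mod 6 = ?l" "(i + 1) mod 6 = Suc i"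
      using Suc.prems by (simp_all add: add.commute)
    \<comment> \<open>The sign passes from one side to the next: the triple \<open>i\<close>,
      \<open>i + 1\<close>, \<open>i + 2\<close> contains both sides, and vertices \<open>i\<close>
      and \<open>i + 3\<close> lie on the same side of the second.\<close>
    have "0 < ?d (Suc i) ((Suc i + 1) mod 6) i * ?d (Suc i) ((Suc i + 1) mod 6) ?l"
      using Suc.prems by (intro same) (simp_all add: mod_if, arith+)
    moreover have "0 < e * ?d i (Suc i) ?k"
      using Suc succ by simp
    moreover have "?d (Suc i) ?k i = ?d i (Suc i) ?k"
      by (rule det3_rotate)
    ultimately show ?case unfolding succ
      by (simp add: zero_less_mult_iff) argo
  qed
  have "e \<noteq> 0" using first[of 0] by auto
  moreover have "0 < det3 (e *\<^sub>R lift (p i)) (e *\<^sub>R lift (p ((i + 1) mod 6))) (e *\<^sub>R lift (p k))"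
    if "i < 6" "k < 6" "k \<noteq> i" "k \<noteq> (i + 1) mod 6" for i k
  proof -
    have "0 < ?d i ((i + 1) mod 6) ((i + 2) mod 6) * ?d i ((i + 1) mod 6) k"
      using that by (intro same) (auto simp: mod_if)
    then have "0 < e * ?d i ((i + 1) mod 6) k"
      using first[OF \<open>i < 6\<close>] by (auto simp: zero_less_mult_iff)
    moreover have "0 < e * e"
      using \<open>e \<noteq> 0\<close> not_real_square_gt_zero by blast
    ultimately have "0 < (e * e) * (e * ?d i ((i + 1) mod 6) k)"
      by simp
    then show ?thesis by (simp add: mult.assoc)
  qed
  ultimately show thesis
    by (intro that[of e]) auto
qed

subsection \<open>The operator in the basis of alternate vertices\<close>

text \<open>The factors of the two neighbours cancel in each quotient, and that of
  \<open>q j\<close> cancels against the vector. A zero denominator is zero for both families, and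
  both terms are then 0.\<close>

lemma glick_lift_independent:
  assumes "\<And>i. i < n \<Longrightarrow> c i \<noteq> 0 \<and> q i = c i *\<^sub>R r i"
  shows "glick n q = glick n r"
proof
  fix v
  have "(det3 (q ((j + (n - 1)) mod n)) v (q ((j + 1) mod n)) /
        det3 (q ((j + (n - 1)) mod n)) (q j) (q ((j + 1) mod n))) *\<^sub>R q j =
      (det3 (r ((j + (n - 1)) mod n)) v (r ((j + 1) mod n)) /
        det3 (r ((j + (n - 1)) mod n)) (r j) (r ((j + 1) mod n))) *\<^sub>R r j" if "j < n" for j
  proof -
    have "n > 0" using that by simp
    then have "(j + (n - 1)) mod n < n" "(j + 1) mod n < n" by simp_all
    note this[THEN assms] assms[OF that]
    then show ?thesis by auto
  qed
  then show "glick n q v = glick n r v"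
    unfolding glick_def by (intro arg_cong2[where f = minus] sum.cong refl) auto
qed

lemma linear_glick: "linear (glick n q)"
  unfolding glick_def
  by (intro linear_compose_sub linear_compose_sum ballI)
    (auto intro!: linearI simp: det3_expand algebra_simps add_divide_distrib diff_divide_distrib)

lemma glick_6_expand:
  "glick 6 q v = 6 *\<^sub>R v - (
     (det3 (q 5) v (q 1) / det3 (q 5) (q 0) (q 1)) *\<^sub>R q 0 +
     (det3 (q 0) v (q 2) / det3 (q 0) (q 1) (q 2)) *\<^sub>R q 1 +
     (det3 (q 1) v (q 3) / det3 (q 1) (q 2) (q 3)) *\<^sub>R q 2 +
     (det3 (q 2) v (q 4) / det3 (q 2) (q 3) (q 4)) *\<^sub>R q 3 +
     (det3 (q 3) v (q 5) / det3 (q 3) (q 4) (q 5)) *\<^sub>R q 4 +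
     (det3 (q 4) v (q 0) / det3 (q 4) (q 5) (q 0)) *\<^sub>R q 5)"
proof -
  have "{..<6::nat} = {0, 1, 2, 3, 4, 5}" by auto
  then show ?thesis by (simp add: glick_def add.assoc flip: numeral_2_eq_2)
qed

text \<open>For consecutive vertices \<open>a\<close> to \<open>f\<close>, the left side is
  \<open>G - I\<close> applied to \<open>a\<close>. Expanding \<open>d\<close> in \<open>a\<close>,
  \<open>c\<close>, \<open>e\<close> gives \<open>a\<close> the coefficient -1, which cancels the
  leading \<open>a\<close>.\<close>

lemma glick_6_vertex:
  assumes "det3 c d e \<noteq> 0"
  shows "a - (det3 b a d / det3 b c d) *\<^sub>R c - (det3 c a e / det3 c d e) *\<^sub>R d
           - (det3 d a f / det3 d e f) *\<^sub>R e =
         (det3 a b d / det3 b c d + det3 a d e / det3 c d e) *\<^sub>R c +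
         (det3 a d f / det3 d e f + det3 a c d / det3 c d e) *\<^sub>R e"
proof -
  have "det3 a c e *\<^sub>R d = det3 d c e *\<^sub>R a + det3 a d e *\<^sub>R c + det3 a c d *\<^sub>R e"
    by (rule det3_cramer)
  then have "(1 / det3 c d e) *\<^sub>R (det3 a c e *\<^sub>R d) =
     (1 / det3 c d e) *\<^sub>R (det3 d c e *\<^sub>R a + det3 a d e *\<^sub>R c + det3 a c d *\<^sub>R e)"
    by simp
  then have "(det3 a c e / det3 c d e) *\<^sub>R d =
     - a + (det3 a d e / det3 c d e) *\<^sub>R c + (det3 a c d / det3 c d e) *\<^sub>R e"
    using assms by (simp add: det3_swap[of d c] scaleR_add_right scaleR_diff_right)
  then show ?thesis
    by (simp add: det3_swap[of b a] det3_swap[of c a] det3_swap[of d a] scaleR_add_left)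
qed

section \<open>Invariants under a change of basis\<close>

lemma det_trace_similar:
  fixes A B N :: "real^'n^'n"
  assumes "A ** B = B ** N" and "det B \<noteq> 0"
  shows "det A = det N" "trace A = trace N"
proof -
  have "det A * det B = det B * det N"
    using assms(1) by (metis det_mul)
  then show "det A = det N" using assms(2) by simp
  obtain C where C: "B ** C = mat 1" "C ** B = mat 1"
    using assms(2) by (metis invertible_det_nz invertible_def)
  have "A = B ** N ** C"
    by (metis assms(1) C(1) matrix_mul_assoc matrix_mul_rid)
  then show "trace A = trace N"
    using trace_mul_sym[of "B ** N" C] C(2) by (simp add: matrix_mul_assoc)
qed

text \<open>\<open>N\<close> is the matrix of \<open>A\<close> in the basis \<open>a\<close>,
  \<open>c\<close>, \<open>e\<close>, the images being its columns. With zero diagonal, the trace of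
  the square counts each 2-cycle twice, and the determinant consists of the two 3-cycles, which are
  even permutations.\<close>

lemma zero_diagonal_invariants:
  fixes A :: "real^3^3"
  assumes a: "A *v a = u1 *\<^sub>R c + u2 *\<^sub>R e"
    and c: "A *v c = v1 *\<^sub>R e + v2 *\<^sub>R a"
    and e: "A *v e = w1 *\<^sub>R a + w2 *\<^sub>R c"
    and basis: "det3 a c e \<noteq> 0"
  shows "trace A = 0" "trace (A ** A) / 2 = u1 * v2 + v1 * w2 + w1 * u2"
    "det A = u1 * v1 * w1 + u2 * v2 * w2"
proof -
  define B where "B = transpose (vector [a, c, e] :: real^3^3)"
  define N :: "real^3^3" where
    "N = vector [vector [0, v2, w1], vector [u1, 0, w2], vector [u2, v1, 0]]"
  have B: "B *v x = x $ 1 *\<^sub>R a + x $ 2 *\<^sub>R c + x $ 3 *\<^sub>R e" for x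
    by (simp add: B_def vec_eq_iff matrix_vector_mult_def transpose_def sum_3)
  have N: "N *v x = vector [x $ 2 * v2 + x $ 3 * w1, x $ 1 * u1 + x $ 3 * w2, x $ 1 * u2 + x $ 2 * v1]" for x
    by (simp add: N_def vec_eq_iff forall_3 matrix_vector_mult_def sum_3)
  have "(A ** B) *v x = (B ** N) *v x" for x
    unfolding matrix_vector_mul_assoc[symmetric] B N
    by (simp add: a c e matrix_vector_mult_scaleR matrix_vector_right_distrib scaleR_add_left
        scaleR_add_right mult.commute add_ac)
  then have AB: "A ** B = B ** N" by (simp add: matrix_eq)
  have B0: "det B \<noteq> 0" using basis by (simp add: B_def det3_def)
  have AAB: "(A ** A) ** B = B ** (N ** N)"
    by (metis AB matrix_mul_assoc)
  show "trace A = 0"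
    using det_trace_similar(2)[OF AB B0] by (simp add: N_def trace_def sum_3)
  show "trace (A ** A) / 2 = u1 * v2 + v1 * w2 + w1 * u2"
    using det_trace_similar(2)[OF AAB B0]
    by (simp add: N_def trace_def matrix_matrix_mult_def sum_3)
  show "det A = u1 * v1 * w1 + u2 * v2 * w2"
    using det_trace_similar(1)[OF AB B0] by (simp add: N_def det_3)
qed

lemma glick_G_minus_1_mult:
  "(glick_G q - mat 1) *v v = glick 6 q v - 4 *\<^sub>R v"
proof -
  have mat: "mat k *v v = k *\<^sub>R v" for k :: real
    by (simp add: vec_eq_iff forall_3 matrix_vector_mult_def mat_def sum_3)
  have "matrix (glick 6 q) *v v = glick 6 q v"
    using matrix_works[of "glick 6 q"] linear_glick by (simp add: linear_def real_scaleR_def)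
  moreover have "(4::real) *\<^sub>R v = 3 *\<^sub>R v + 1 *\<^sub>R v"
    by (simp add: vec_eq_iff)
  ultimately show ?thesis
    by (simp add: glick_G_def matrix_vector_mult_diff_rdistrib mat)
qed

lemma glick_invariants_of_oriented:
  assumes pos: "\<And>i k. i < 6 \<Longrightarrow> k < 6 \<Longrightarrow> k \<noteq> i \<Longrightarrow> k \<noteq> (i + 1) mod 6 \<Longrightarrow>
      0 < det3 (q i) (q ((i + 1) mod 6)) (q k)"
  shows "trace (glick_G q - mat 1) = 0" "0 < glick_S q" "0 < glick_R q"
proof -
  let ?d = "\<lambda>i j k. det3 (q i) (q j) (q k)"
  have adj: "0 < ?d i j k" if "(i, j) \<in> {(0,1), (1,2), (2,3), (3,4), (4,5), (5,0)}" "k \<in> {0,1,2,3,4,5} - {i, j}"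
    for i j k
  proof -
    have "i < 6 \<and> k < 6 \<and> k \<noteq> i \<and> j = (i + 1) mod 6"
      using that by auto
    then show ?thesis using pos that by auto
  qed
  have adj': "0 < ?d k i j" "0 < ?d j k i"
    if "(i, j) \<in> {(0,1), (1,2), (2,3), (3,4), (4,5), (5,0)}" "k \<in> {0,1,2,3,4,5} - {i, j}" for i j k
    using adj[OF that] by (simp_all only: det3_rotate)
  \<comment> \<open>Every factor other than \<open>?d 0 2 4\<close> contains a side and is already
    known to be positive.\<close>
  have "?d 0 1 3 * ?d 0 2 4 = ?d 0 1 2 * ?d 0 3 4 + ?d 0 1 4 * ?d 0 2 3"
    by (rule det3_plucker)
  moreover have "0 < ?d 0 1 3" "0 < ?d 0 1 2" "0 < ?d 0 3 4" "0 < ?d 0 1 4" "0 < ?d 0 2 3"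
    by (simp_all add: adj adj')
  ultimately have d024: "0 < ?d 0 2 4"
    by (smt (verit) mult_pos_pos zero_less_mult_pos)
  \<comment> \<open>\<open>n\<close> and \<open>m\<close> are the two coefficients in
    \<open>glick_6_vertex\<close>. Each of their determinants contains a side, the closing side from
    \<open>f\<close> to \<open>a\<close> included.\<close>
  define n where "n a b c d e f = ?d a b d / ?d b c d + ?d a d e / ?d c d e" for a b c d e f :: nat
  define m where "m a b c d e f = ?d a d f / ?d d e f + ?d a c d / ?d c d e" for a b c d e f :: nat
  have npos: "0 < n 0 1 2 3 4 5" "0 < n 2 3 4 5 0 1" "0 < n 4 5 0 1 2 3"
    "0 < m 0 1 2 3 4 5" "0 < m 2 3 4 5 0 1" "0 < m 4 5 0 1 2 3"
    by (simp_all add: n_def m_def adj adj' add_pos_pos)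
  \<comment> \<open>The summand at the vertex \<open>v\<close> is \<open>v\<close> itself and those
    at its neighbours vanish, so that 6 - 1 - 4 = 1 copy of \<open>v\<close> remains.\<close>
  have step: "(glick_G q - mat 1) *v v = w"
    if "glick 6 q v = 6 *\<^sub>R v - (v + x + y + z)" "v - x - y - z = w" for v w x y z
    unfolding glick_G_minus_1_mult that(1) that(2)[symmetric]
    by (simp add: vec_eq_iff)
  have nz: "?d 5 0 1 \<noteq> 0" "?d 1 2 3 \<noteq> 0" "?d 3 4 5 \<noteq> 0" "?d 2 3 4 \<noteq> 0" "?d 4 5 0 \<noteq> 0" "?d 0 1 2 \<noteq> 0"
    by (rule less_imp_neq[symmetric], rule adj, simp, simp)+
  have v0: "(glick_G q - mat 1) *v q 0 = n 0 1 2 3 4 5 *\<^sub>R q 2 + m 0 1 2 3 4 5 *\<^sub>R q 4"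
    unfolding n_def m_def
    by (rule step[OF _ glick_6_vertex[OF nz(4)]])
      (simp only: glick_6_expand det3_same nz divide_self_if if_False div_0 scaleR_zero_left scaleR_one add_0_left add_0_right add_ac)
  have v2: "(glick_G q - mat 1) *v q 2 = n 2 3 4 5 0 1 *\<^sub>R q 4 + m 2 3 4 5 0 1 *\<^sub>R q 0"
    unfolding n_def m_def
    by (rule step[OF _ glick_6_vertex[OF nz(5)]])
      (simp only: glick_6_expand det3_same nz divide_self_if if_False div_0 scaleR_zero_left scaleR_one add_0_left add_0_right add_ac)
  have v4: "(glick_G q - mat 1) *v q 4 = n 4 5 0 1 2 3 *\<^sub>R q 0 + m 4 5 0 1 2 3 *\<^sub>R q 2"
    unfolding n_def m_def
    by (rule step[OF _ glick_6_vertex[OF nz(6)]])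
      (simp only: glick_6_expand det3_same nz divide_self_if if_False div_0 scaleR_zero_left scaleR_one add_0_left add_0_right add_ac)
  show "trace (glick_G q - mat 1) = 0" "0 < glick_S q" "0 < glick_R q"
    using zero_diagonal_invariants[OF v0 v2 v4] d024 npos
    by (simp_all add: glick_S_def glick_R_def add_pos_pos)
qed

subsection \<open>The spectrum\<close>

text \<open>For \<open>M = A - I\<close> of trace 0 the sum of the principal 2-minors is -tr(M^2)/2.
  The cubic of \<open>M\<close> is then evaluated at x - 1.\<close>

lemma charpoly_one_plus_traceless:
  fixes A :: "real^3^3"
  assumes "trace (A - mat 1) = 0"
  shows "charpoly (\<chi> i j. complex_of_real (A $ i $ j)) =
    [:-1, 1:] ^ 3 - smult (of_real (trace ((A - mat 1) ** (A - mat 1)) / 2)) [:-1, 1:]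
      - [:of_real (det (A - mat 1)):]"
proof -
  have a: "A $ 3 $ 3 = 3 - A $ 1 $ 1 - A $ 2 $ 2"
    using assms by (simp add: trace_def sum_3 mat_def)
  show ?thesis
    by (simp add: charpoly_def det_3 trace_def sum_3 matrix_matrix_mult_def mat_def a
        eval_nat_numeral field_simps)
qed

lemma proots_three_linear:
  "proots ([:- a, 1:] * [:- b, 1:] * [:- c, 1:]) = {#a, b, c :: 'a :: field#}"
proof -
  have "[:- a, 1:] * [:- b, 1:] \<noteq> 0" by (simp only: mult_eq_0_iff) simp
  then show ?thesis
    by (simp add: proots_mult add_mset_commute del: mult_pCons_left mult_pCons_right)
qed

lemma strictly_dominant_unique:
  assumes "strictly_dominant l M" "strictly_dominant l' M"
  shows "l = l'"
  using assms unfolding strictly_dominant_def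
  by (metis in_diff_count insert_noteq_member order_less_asym set_mset_add_mset_insert insert_DiffM insertE)

lemma strictly_dominant_three:
  "strictly_dominant a {#a, b, c#} \<longleftrightarrow> cmod b < cmod a \<and> cmod c < cmod a"
  by (auto simp: strictly_dominant_def)

section \<open>The positive root of the cubic and the resulting spectrum\<close>

lemma positive_root_exists:
  fixes S R :: real
  assumes "S > 0" "R > 0"
  obtains m where "m > 0" "m ^ 3 - S * m = R"
proof -
  let ?f = "\<lambda>x. x ^ 3 - S * x"
  \<comment> \<open>For x = 1 + S + R one has x^2 - S \<ge> 1, so x (x^2 - S) \<ge> x \<ge>
    R.\<close>
  have "R \<le> ?f (1 + S + R)"
    using assms by (simp add: power3_eq_cube algebra_simps)
  moreover have "?f 0 \<le> R" using assms by simp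
  moreover have "continuous_on {0..1 + S + R} ?f" by (intro continuous_intros)
  ultimately obtain m where "0 \<le> m" "?f m = R"
    using IVT'[of ?f 0 R "1 + S + R"] assms by auto
  moreover from this have "m \<noteq> 0" using assms by auto
  ultimately show thesis using that[of m] by simp
qed

text \<open>The cubic factors as (x - m)(x^2 + m x + m^2 - S), and by Vieta \<open>z\<close> and
  \<open>w\<close> are the roots of the quadratic. Complex \<open>z\<close> and \<open>w\<close>
  cover real and conjugate pairs alike.\<close>

lemma Spec_one_plus_traceless:
  fixes A :: "real^3^3"
  assumes tr: "trace (A - mat 1) = 0"
    and S: "S = trace ((A - mat 1) ** (A - mat 1)) / 2"
    and R: "det (A - mat 1) = m ^ 3 - S * m"
    and sum: "z + w = - of_real m" and prod: "z * w = of_real (m\<^sup>2 - S)"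
  shows "Spec A = {#of_real (1 + m), 1 + z, 1 + w#}"
proof -
  have w: "w = - of_real m - z" using sum by (metis add_diff_cancel_left')
  have S': "complex_of_real S = of_real m ^ 2 - z * w" using prod by simp
  have "charpoly (\<chi> i j. complex_of_real (A $ i $ j)) =
    [:-1, 1:] ^ 3 - smult (of_real S) [:-1, 1:] - [:of_real m ^ 3 - of_real S * of_real m:]"
    by (simp only: charpoly_one_plus_traceless[OF tr] R S[symmetric] of_real_diff of_real_mult of_real_power)
  also have "\<dots> = [:- of_real (1 + m), 1:] * [:- (1 + z), 1:] * [:- (1 + w), 1:]"
    unfolding S' w by (simp add: eval_nat_numeral algebra_simps)
  finally show ?thesis
    unfolding Spec_def by (simp only: proots_three_linear)
qed

lemma spectral_trichotomy:
  fixes A :: "real^3^3"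
  assumes tr: "trace (A - mat 1) = 0"
    and S: "S = trace ((A - mat 1) ** (A - mat 1)) / 2" and R: "R = det (A - mat 1)"
    and pos: "S > 0" "R > 0"
    and D: "D = 4 * S ^ 3 - 27 * R\<^sup>2"
  shows "(\<exists>!l. strictly_dominant l (Spec A))
    \<and> (D < 0 \<longrightarrow>
         (\<exists>(r::real) z. z \<notin> \<real> \<and> Spec A = {#of_real r, z, cnj z#}
            \<and> strictly_dominant (of_real r) (Spec A)))
    \<and> (D = 0 \<longrightarrow>
         (\<exists>!s::real. s > 0 \<and>
            Spec A = {#of_real (1 + 2 * s), of_real (1 - s), of_real (1 - s)#})
         \<and> (\<forall>s::real. s > 0 \<and>
            Spec A = {#of_real (1 + 2 * s), of_real (1 - s), of_real (1 - s)#}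
              \<longrightarrow> strictly_dominant (of_real (1 + 2 * s)) (Spec A)))
    \<and> (D > 0 \<longrightarrow>
         (\<exists>(a::real) (b::real) (c::real).
            Spec A = {#of_real a, of_real b, of_real c#}
            \<and> strictly_dominant (of_real a) (Spec A)
            \<and> (\<bar>b\<bar> = \<bar>c\<bar> \<longleftrightarrow> R = 8 - 2 * S \<and> 3 < S \<and> S < 4)
            \<and> (\<bar>b\<bar> = \<bar>c\<bar> \<longrightarrow>
                 Spec A = {#3, of_real (sqrt (S - 3)), of_real (- sqrt (S - 3))#})))"
proof -
  obtain m where m: "m > 0" "m ^ 3 - S * m = R"
    using positive_root_exists pos by blast
  have "m * (m\<^sup>2 - S) > 0"
    using m pos by (simp add: power2_eq_square power3_eq_cube algebra_simps)
  then have mS: "m\<^sup>2 > S" using m by (simp add: zero_less_mult_iff)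
  \<comment> \<open>The discriminant of the quadratic. The other factor of \<open>D\<close> is the
    square of the value of the quadratic at \<open>m\<close>.\<close>
  define E where "E = 4 * S - 3 * m\<^sup>2"
  have "D = E * (3 * m\<^sup>2 - S)\<^sup>2"
    unfolding D E_def m(2)[symmetric] by (simp add: power2_eq_square power3_eq_cube algebra_simps)
  moreover have "3 * m\<^sup>2 - S > 0" using mS pos by linarith
  then have "(3 * m\<^sup>2 - S)\<^sup>2 > 0" by simp
  ultimately have DE: "D < 0 \<longleftrightarrow> E < 0" "D = 0 \<longleftrightarrow> E = 0" "D > 0 \<longleftrightarrow> E > 0"
    by (auto simp: mult_less_0_iff zero_less_mult_iff)
  have spec: "Spec A = {#of_real (1 + m), 1 + z, 1 + w#}"
    if "z + w = - of_real m" "z * w = of_real (m\<^sup>2 - S)" for z w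
    using Spec_one_plus_traceless[OF tr S _ that] m R by simp
  have neg: "\<exists>z. z \<notin> \<real> \<and> Spec A = {#of_real (1 + m), z, cnj z#}
      \<and> strictly_dominant (of_real (1 + m)) (Spec A)" if "E < 0"
  proof -
    define z where "z = Complex (- m / 2) (sqrt (- E) / 2)"
    have sq: "sqrt (- E) * sqrt (- E) = - E" using that by simp
    have "z + cnj z = - of_real m" by (simp add: z_def complex_eq_iff)
    moreover have "z * cnj z = of_real (m\<^sup>2 - S)"
      using sq by (simp add: z_def complex_eq_iff power2_eq_square E_def field_simps)
    ultimately have sp: "Spec A = {#of_real (1 + m), 1 + z, 1 + cnj z#}"
      by (rule spec)
    have im: "1 + z \<notin> \<real>" using that by (simp add: complex_is_Real_iff z_def)
    \<comment> \<open>This is 1 + (z + cnj z) + z * cnj z; it falls short of (1 + m)^2 by 3 m +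
      S.\<close>
    have "(cmod (1 + z))\<^sup>2 = 1 - m + m\<^sup>2 - S"
      unfolding cmod_power2 using sq by (simp add: z_def power2_eq_square E_def field_simps)
    also have "\<dots> < (1 + m)\<^sup>2"
      using m pos by (simp add: power2_eq_square algebra_simps)
    finally have "cmod (1 + z) < 1 + m"
      using m power_less_imp_less_base by fastforce
    moreover have "cmod (1 + cnj z) = cmod (1 + z)"
      using complex_mod_cnj[of "1 + z"] by simp
    moreover have "cmod (of_real (1 + m)) = 1 + m"
      using m by (simp only: norm_of_real)
    ultimately have "strictly_dominant (of_real (1 + m)) (Spec A)"
      unfolding sp strictly_dominant_three by simp
    then show ?thesis using sp im by (intro exI[of _ "1 + z"]) simp
  qed
  define h where "h = sqrt E / 2"
  have nonneg: "Spec A = {#of_real (1 + m), of_real (1 - m / 2 + h), of_real (1 - m / 2 - h)#}"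
    "strictly_dominant (of_real (1 + m)) (Spec A)" if "E \<ge> 0"
  proof -
    have sq: "4 * (h * h) = E" using that by (simp add: h_def)
    have "complex_of_real (h - m / 2) + of_real (- h - m / 2) = - of_real m"
      unfolding of_real_add[symmetric] of_real_minus[symmetric] of_real_eq_iff by simp
    moreover have "complex_of_real (h - m / 2) * of_real (- h - m / 2) = of_real (m\<^sup>2 - S)"
      using sq unfolding of_real_mult[symmetric] of_real_eq_iff
      by (simp add: power2_eq_square E_def field_simps)
    moreover have "1 + complex_of_real (h - m / 2) = of_real (1 - m / 2 + h)"
      "1 + complex_of_real (- h - m / 2) = of_real (1 - m / 2 - h)"
      by simp_all
    ultimately show sp: "Spec A = {#of_real (1 + m), of_real (1 - m / 2 + h), of_real (1 - m / 2 - h)#}"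
      by (metis spec)
    \<comment> \<open>Hence both roots of the quadratic lie strictly between -m and 0, and adding 1
      leaves moduli below 1 + m.\<close>
    have "E < m\<^sup>2" using mS by (simp add: E_def)
    then have "h < m / 2" using m by (simp add: h_def real_less_lsqrt)
    moreover have "0 \<le> h" using that by (simp add: h_def)
    ultimately have "\<bar>1 - m / 2 + h\<bar> < \<bar>1 + m\<bar>" "\<bar>1 - m / 2 - h\<bar> < \<bar>1 + m\<bar>"
      using m(1) by - linarith+
    then show "strictly_dominant (of_real (1 + m)) (Spec A)"
      by (simp only: sp strictly_dominant_three norm_of_real simp_thms)
  qed
  have dom: "strictly_dominant (of_real (1 + m)) (Spec A)"
    using neg nonneg(2) by (cases "E < 0") auto
  then have "\<exists>!l. strictly_dominant l (Spec A)"
    using strictly_dominant_unique by blast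
  moreover have "\<exists>(r::real) z. z \<notin> \<real> \<and> Spec A = {#of_real r, z, cnj z#}
            \<and> strictly_dominant (of_real r) (Spec A)" if "D < 0"
    using neg that DE by blast
  moreover have "(\<exists>!s::real. s > 0 \<and>
            Spec A = {#of_real (1 + 2 * s), of_real (1 - s), of_real (1 - s)#})
         \<and> (\<forall>s::real. s > 0 \<and>
            Spec A = {#of_real (1 + 2 * s), of_real (1 - s), of_real (1 - s)#}
              \<longrightarrow> strictly_dominant (of_real (1 + 2 * s)) (Spec A))" if "D = 0"
  proof -
    let ?P = "\<lambda>s::real. s > 0 \<and> Spec A = {#of_real (1 + 2 * s), of_real (1 - s), of_real (1 - s)#}"
    have "?P (m / 2)"
      using nonneg(1) m that DE by (simp add: h_def)
    moreover have P_dom: "strictly_dominant (of_real (1 + 2 * s)) (Spec A)" if "?P s" for s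
    proof -
      have "\<bar>1 - s\<bar> < \<bar>1 + 2 * s\<bar>" using that by auto
      then show ?thesis using that
        by (simp only: strictly_dominant_three norm_of_real)
    qed
    \<comment> \<open>Any admissible \<open>s\<close> makes 1 + 2 s strictly dominant, so uniqueness
      of the dominant element identifies it with 1 + m.\<close>
    moreover have "s = m / 2" if "?P s" for s
    proof -
      have "complex_of_real (1 + 2 * s) = of_real (1 + m)"
        using strictly_dominant_unique[OF P_dom[OF that] dom] .
      then show ?thesis unfolding of_real_eq_iff by simp
    qed
    ultimately show ?thesis by blast
  qed
  moreover have "\<exists>(a::real) (b::real) (c::real).
            Spec A = {#of_real a, of_real b, of_real c#}
            \<and> strictly_dominant (of_real a) (Spec A)
            \<and> (\<bar>b\<bar> = \<bar>c\<bar> \<longleftrightarrow> R = 8 - 2 * S \<and> 3 < S \<and> S < 4)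
            \<and> (\<bar>b\<bar> = \<bar>c\<bar> \<longrightarrow>
                 Spec A = {#3, of_real (sqrt (S - 3)), of_real (- sqrt (S - 3))#})" if "D > 0"
  proof -
    have E: "E > 0" using that DE by simp
    define b where "b = 1 - m / 2 + h"
    define c where "c = 1 - m / 2 - h"
    have sp: "Spec A = {#of_real (1 + m), of_real b, of_real c#}"
      using nonneg(1) E by (simp only: b_def c_def less_imp_le)
    \<comment> \<open>Since \<open>b\<close> and \<open>c\<close> differ, equal moduli mean
      \<open>b + c = 0\<close>, that is 2 - m = 0.\<close>
    have "h > 0" using E by (simp add: h_def)
    then have abs: "\<bar>b\<bar> = \<bar>c\<bar> \<longleftrightarrow> m = 2"
      unfolding b_def c_def by linarith
    have "R = 8 - 2 * S \<longleftrightarrow> (m - 2) * (m\<^sup>2 + 2 * m + 4 - S) = 0"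
      unfolding m(2)[symmetric] by (simp add: power2_eq_square power3_eq_cube algebra_simps)
    also have "\<dots> \<longleftrightarrow> m = 2" using mS m by auto
    finally have R2: "R = 8 - 2 * S \<longleftrightarrow> m = 2" .
    \<comment> \<open>For m = 2, positivity of \<open>E\<close> and m^2 > S become the two
      bounds.\<close>
    have S2: "3 < S" "S < 4" if "m = 2"
      using E mS that by (simp_all add: E_def)
    have "Spec A = {#3, of_real (sqrt (S - 3)), of_real (- sqrt (S - 3))#}" if "m = 2"
    proof -
      have "E = 4 * (S - 3)" using that by (simp add: E_def)
      then have "h = sqrt (S - 3)" by (simp only: h_def real_sqrt_mult) simp
      then show ?thesis using sp that by (simp add: b_def c_def)
    qed
    then show ?thesis
      using sp dom abs R2 S2 by (intro exI[of _ "1 + m"] exI[of _ b] exI[of _ c]) auto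
  qed
  ultimately show ?thesis by blast
qed

theorem corollary5p19:
  fixes p :: "nat \<Rightarrow> real^2" and q :: "nat \<Rightarrow> real^3"
  assumes "strictly_convex_polygon 6 p"
    and "\<forall>i<6. homogeneous_lift (q i) (p i)"
  shows "glick_S q > 0 \<and> glick_R q > 0
    \<and> (\<exists>!l. strictly_dominant l (Spec (glick_G q)))
    \<and> (glick_Delta q < 0 \<longrightarrow>
         (\<exists>(r::real) z. z \<notin> \<real> \<and> Spec (glick_G q) = {#of_real r, z, cnj z#}
            \<and> strictly_dominant (of_real r) (Spec (glick_G q))))
    \<and> (glick_Delta q = 0 \<longrightarrow>
         (\<exists>!s::real. s > 0 \<and>
            Spec (glick_G q) = {#of_real (1 + 2 * s), of_real (1 - s), of_real (1 - s)#})
         \<and> (\<forall>s::real. s > 0 \<and>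
            Spec (glick_G q) = {#of_real (1 + 2 * s), of_real (1 - s), of_real (1 - s)#}
              \<longrightarrow> strictly_dominant (of_real (1 + 2 * s)) (Spec (glick_G q))))
    \<and> (glick_Delta q > 0 \<longrightarrow>
         (\<exists>(a::real) (b::real) (c::real).
            Spec (glick_G q) = {#of_real a, of_real b, of_real c#}
            \<and> strictly_dominant (of_real a) (Spec (glick_G q))
            \<and> (\<bar>b\<bar> = \<bar>c\<bar> \<longleftrightarrow>
                 glick_R q = 8 - 2 * glick_S q \<and> 3 < glick_S q \<and> glick_S q < 4)
            \<and> (\<bar>b\<bar> = \<bar>c\<bar> \<longrightarrow>
                 Spec (glick_G q) =
                   {#3, of_real (sqrt (glick_S q - 3)), of_real (- sqrt (glick_S q - 3))#})))"
proof -
  obtain e :: real where e: "e \<noteq> 0"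
    and pos: "\<And>i k. i < 6 \<Longrightarrow> k < 6 \<Longrightarrow> k \<noteq> i \<Longrightarrow> k \<noteq> (i + 1) mod 6 \<Longrightarrow>
      0 < det3 (e *\<^sub>R lift (p i)) (e *\<^sub>R lift (p ((i + 1) mod 6))) (e *\<^sub>R lift (p k))"
    using convex_hexagon_oriented_lift[OF assms(1)] by blast
  \<comment> \<open>The signs are known for the oriented lifts \<open>r\<close>; rescaling carries
    them to the given lifts \<open>q\<close> without changing the operator.\<close>
  define r where "r i = e *\<^sub>R lift (p i)" for i
  have "\<exists>c. c \<noteq> 0 \<and> q i = c *\<^sub>R r i" if "i < 6" for i
  proof -
    obtain c where "c \<noteq> 0" "q i = c *\<^sub>R lift (p i)"
      using assms(2) \<open>i < 6\<close> unfolding homogeneous_lift_def lift_def by blast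
    then show ?thesis using e by (intro exI[of _ "c / e"]) (simp add: r_def)
  qed
  then obtain c where "\<And>i. i < 6 \<Longrightarrow> c i \<noteq> 0 \<and> q i = c i *\<^sub>R r i"
    by metis
  then have "glick 6 q = glick 6 r"
    by (rule glick_lift_independent)
  then have G: "glick_G q = glick_G r" by (simp add: glick_G_def)
  have tr: "trace (glick_G q - mat 1) = 0" and "0 < glick_S q" "0 < glick_R q"
    using glick_invariants_of_oriented[of r] pos by (simp_all add: G glick_S_def glick_R_def r_def)
  then show ?thesis
    using spectral_trichotomy[OF tr glick_S_def glick_R_def _ _ glick_Delta_def] by blast
qed

end
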